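(* Let $d\ge1$ and let $\mathcal{P}_{\mathcal{D}}$ be the exponential family of extended truncated multivariate normal distributions on $\mathbb{R}_+^d$, with densities $$p(\boldsymbol{t};\boldsymbol{\theta},\boldsymbol{\Theta})=\exp\big(\boldsymbol{\theta}'\boldsymbol{t}-\boldsymbol{t}'\boldsymbol{\Theta}\boldsymbol{t}-K_T(\boldsymbol{\theta},\boldsymbol{\Theta})\big),\quad \boldsymbol{t}\in\mathbb{R}_+^d,\qquad(\boldsymbol{\theta},\boldsymbol{\Theta})\in\mathcal{D},$$ and canonical parameter space $\mathcal{D}=\{(\boldsymbol{\theta},\boldsymbol{\Theta})\in\mathbb{R}^d\times\mathcal{S}^{d\times d}:L_T(\boldsymbol{\theta},\boldsymbol{\Theta})<\infty\}$. Then the exponential family $\mathcal{P}_{\mathcal{D}}$ is not steep.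
   Context: Notation: $\mathbb{R}_+^d$ is the nonnegative orthant; a prime denotes transpose; $\mathcal{S}^{d\times d}$ is the space of real symmetric $d\times d$ matrices; $$L_T(\boldsymbol{\theta},\boldsymbol{\Theta})=\int_{\mathbb{R}_+^d}\exp(\boldsymbol{\theta}'\boldsymbol{w}-\boldsymbol{w}'\boldsymbol{\Theta}\boldsymbol{w})\,d\boldsymbol{w},\qquad K_T=\log L_T.$$ Steepness: Let $\Omega=\mathrm{Int}(\mathcal{D})$ (interior in $\mathbb{R}^d\times\mathcal{S}^{d\times d}$) and $\partial\Omega=\mathrm{cl}(\Omega)\cap\mathrm{cl}(\Omega^c)$. Write $\boldsymbol{\omega}=(\boldsymbol{\theta},\boldsymbol{\Theta})$. With $\nabla_{\boldsymbol{\theta}}=(\partial/\partial\theta_1,\ldots,\partial/\partial\theta_d)'$ and, for $\boldsymbol{\Theta}=(\theta_{i,j})$, $\nabla_{\boldsymbol{\Theta}}=\big(\tfrac12(1+\delta_{i,j})\,\partial/\partial\theta_{i,j}\big)_{i,j}$ (a symmetric matrix of operators), define $$\|\nabla_{\boldsymbol{\omega}}K_T(\boldsymbol{\theta},\boldsymbol{\Theta})\|=\big[\|\nabla_{\boldsymbol{\theta}}K_T(\boldsymbol{\theta},\boldsymbol{\Theta})\|^2+\|\nabla_{\boldsymbol{\Theta}}K_T(\boldsymbol{\theta},\boldsymbol{\Theta})\|_F^2\big]^{1/2},$$ where $\|\cdot\|$ is the Euclidean norm and $\|\cdot\|_F$ the Frobenius norm. The family is steep at $\boldsymbol{\omega}_0\in\partial\Omega$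 if $\|\nabla_{\boldsymbol{\omega}}K_T(\boldsymbol{\omega})\|\to\infty$ as $\boldsymbol{\omega}\to\boldsymbol{\omega}_0$ (with $\boldsymbol{\omega}\in\Omega$); it is steep if it is steep at every point $\boldsymbol{\omega}_0\in\partial\Omega$. *)

theory Defs
  imports "HOL-Analysis.Analysis"
begin

type_synonym 'n param = "(real ^ 'n) \<times> (real ^ 'n ^ 'n)"

definition nonneg_orthant :: "(real ^ 'n) set" where
  "nonneg_orthant = {w. \<forall>i. 0 \<le> w $ i}"

definition sym_mats :: "(real ^ 'n ^ 'n) set" where
  "sym_mats = {\<Theta>. transpose \<Theta> = \<Theta>}"

text \<open>The ambient space \<open>\<real>\<^sup>d \<times> \<S>\<close> of all parameters. Interiors and boundaries are taken
  relative to this subspace; within all of \<^typ>\<open>'n param\<close> it has empty interior if \<open>d \<ge> 2\<close>.\<close>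

definition param_top :: "'n::finite param topology" where
  "param_top = top_of_set (UNIV \<times> sym_mats)"


text \<open>The canonical statistic is \<open>(t, - t t')\<close>: a density has the form
  \<open>exp (\<theta> \<bullet> t - t \<bullet> (\<Theta> *v t) - K (\<theta>, \<Theta>))\<close> on the support, with \<open>K\<close> the cumulant. Steepness is
  a property of \<open>K\<close> on the interior of the parameter space.\<close>

record 'n exp_family =
  params :: "'n param set"                          \<comment> \<open>canonical parameter space\<close>
  cumulant :: "'n param \<Rightarrow> real"                    \<comment> \<open>log-partition function\<close>
  dens :: "'n param \<Rightarrow> real ^ 'n \<Rightarrow> real"           \<comment> \<open>densities w.r.t. Lebesgue measure\<close>

definition grad_theta :: "('n::finite param \<Rightarrow> real) \<Rightarrow> 'n param \<Rightarrow> real ^ 'n" where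
  "grad_theta K \<omega> = (\<chi> i. deriv (\<lambda>h. K (fst \<omega> + h *\<^sub>R axis i 1, snd \<omega>)) 0)"

text \<open>The coordinate \<open>\<theta>\<^sub>i\<^sub>j = \<theta>\<^sub>j\<^sub>i\<close> of a symmetric matrix occupies the entries \<open>(i,j)\<close> and \<open>(j,i)\<close>,
  so the partial derivative with respect to it moves both of them.\<close>

definition sym_unit :: "'n \<Rightarrow> 'n \<Rightarrow> real ^ 'n ^ 'n" where
  "sym_unit i j = (\<chi> k l. if (k = i \<and> l = j) \<or> (k = j \<and> l = i) then 1 else 0)"

definition grad_Theta :: "('n::finite param \<Rightarrow> real) \<Rightarrow> 'n param \<Rightarrow> real ^ 'n ^ 'n" where
  "grad_Theta K \<omega> = (\<chi> i j. 1/2 * (1 + (if i = j then 1 else 0)) *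
     deriv (\<lambda>h. K (fst \<omega>, snd \<omega> + h *\<^sub>R sym_unit i j)) 0)"

text \<open>On \<^typ>\<open>real ^ 'n ^ 'n\<close> the library norm is the Frobenius norm.\<close>

definition grad_norm :: "('n::finite param \<Rightarrow> real) \<Rightarrow> 'n param \<Rightarrow> real" where
  "grad_norm K \<omega> = sqrt ((norm (grad_theta K \<omega>))\<^sup>2 + (norm (grad_Theta K \<omega>))\<^sup>2)"

definition steep_at :: "'n::finite exp_family \<Rightarrow> 'n param \<Rightarrow> bool" where
  "steep_at P \<omega>\<^sub>0 \<longleftrightarrow>
     filterlim (grad_norm (cumulant P)) at_top (at \<omega>\<^sub>0 within (param_top interior_of params P))"

definition steep :: "'n::finite exp_family \<Rightarrow> bool" where
  "steep P \<longleftrightarrow>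
     (\<forall>\<omega>\<^sub>0 \<in> param_top frontier_of (param_top interior_of params P). steep_at P \<omega>\<^sub>0)"


definition etmn_exponent :: "'n::finite param \<Rightarrow> real ^ 'n \<Rightarrow> real" where
  "etmn_exponent \<omega> w = fst \<omega> \<bullet> w - w \<bullet> (snd \<omega> *v w)"

definition etmn_L :: "'n::finite param \<Rightarrow> ennreal" where
  "etmn_L \<omega> = (\<integral>\<^sup>+ w \<in> nonneg_orthant. ennreal (exp (etmn_exponent \<omega> w)) \<partial>lborel)"

definition etmn_K :: "'n::finite param \<Rightarrow> real" where
  "etmn_K \<omega> = ln (enn2real (etmn_L \<omega>))"

definition etmn_D :: "'n::finite param set" where
  "etmn_D = {\<omega>. snd \<omega> \<in> sym_mats \<and> etmn_L \<omega> < \<infinity>}"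

definition etmn_density :: "'n::finite param \<Rightarrow> real ^ 'n \<Rightarrow> real" where
  "etmn_density \<omega> t =
     (if t \<in> nonneg_orthant then exp (etmn_exponent \<omega> t - etmn_K \<omega>) else 0)"

definition etmn_family :: "'n::finite exp_family" where
  "etmn_family = \<lparr>params = etmn_D, cumulant = etmn_K, dens = etmn_density\<rparr>"

end

theory Submission imports Defs "HOL-Real_Asymp.Real_Asymp" begin

text \<open>Steepness fails at the boundary point with \<open>\<theta> = (-1, \<dots>, -1)\<close> and \<open>\<Theta> = 0\<close>. There the
  density is a product of exponential densities, so all moments are finite, although arbitrarily
  small perturbations of \<open>\<Theta>\<close> make the partition function infinite.

  The point is approached along \<open>\<theta> = (-1, \<dots>, -1)\<close>, \<open>\<Theta> = \<epsilon> I\<close> with \<open>\<epsilon> \<rightarrow> 0+\<close>. For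
  \<open>\<epsilon> > 0\<close> these parameters are interior: nearby \<open>\<Theta>\<close> are still positive definite, and nearby
  \<open>\<theta>\<close> still have negative entries (\<open>isotropic_in_interior\<close>). For \<open>\<epsilon> < 0\<close> the exponent is
  bounded below on the orthant, which has infinite volume, so \<open>L\<^sub>T = \<infinity>\<close>. Hence the limit
  lies on the boundary of the interior (\<open>isotropic_in_frontier\<close>).

  Along this path the gradient of \<open>K\<^sub>T\<close> stays bounded. A directional derivative of \<open>K\<^sub>T\<close> is
  the expectation of a statistic that grows at most quadratically
  (\<open>has_real_derivative_etmn_K\<close>), that is, a quotient of two integrals. For \<open>0 < \<epsilon> \<le> 1\<close> the
  weight \<open>exp (- \<Sum>\<^sub>i w\<^sub>i - \<epsilon> \<bar>w\<bar>\<^sup>2)\<close> lies between its values at \<open>\<epsilon> = 1\<close> and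
  \<open>\<epsilon> = 0\<close>. The first bounds the denominator away from zero and the second bounds the numerator,
  both uniformly in \<open>\<epsilon>\<close> (\<open>abs_deriv_etmn_K_le\<close>).\<close>

section \<open>Quadratic forms and exponents\<close>

lemma norm_matrix_vector_le:
  fixes A :: "real ^ 'n ^ 'm" and w :: "real ^ 'n"
  shows "norm (A *v w) \<le> norm A * norm w"
proof -
  have "norm (A *v w) = L2_set (\<lambda>i. \<bar>A $ i \<bullet> w\<bar>) UNIV"
    by (simp add: norm_vec_def matrix_vector_mul_component)
  also have "\<dots> \<le> L2_set (\<lambda>i. norm (A $ i) * norm w) UNIV"
    by (intro L2_set_mono Cauchy_Schwarz_ineq2) auto
  also have "\<dots> = norm A * norm w"
    by (simp add: norm_vec_def[of A] L2_set_left_distrib)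
  finally show ?thesis .
qed

lemma abs_quadratic_form_le:
  fixes A :: "real ^ 'n ^ 'n" and w :: "real ^ 'n"
  shows "\<bar>w \<bullet> (A *v w)\<bar> \<le> norm A * (norm w)\<^sup>2"
proof -
  have "\<bar>w \<bullet> (A *v w)\<bar> \<le> norm w * norm (A *v w)"
    by (rule Cauchy_Schwarz_ineq2)
  also have "\<dots> \<le> norm w * (norm A * norm w)"
    by (intro mult_left_mono norm_matrix_vector_le) auto
  finally show ?thesis by (simp add: power2_eq_square mult_ac)
qed

lemma etmn_exponent_add: "etmn_exponent (\<omega> + \<eta>) w = etmn_exponent \<omega> w + etmn_exponent \<eta> w"
  by (simp add: etmn_exponent_def inner_add_left inner_add_right matrix_vector_mult_add_rdistrib)

lemma etmn_exponent_scaleR: "etmn_exponent (h *\<^sub>R \<eta>) w = h * etmn_exponent \<eta> w"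
  by (simp add: etmn_exponent_def flip: scaleR_matrix_vector_assoc) (simp add: algebra_simps)

lemma abs_etmn_exponent_le:
  "\<bar>etmn_exponent \<eta> w\<bar> \<le> norm (fst \<eta>) * norm w + norm (snd \<eta>) * (norm w)\<^sup>2"
  using Cauchy_Schwarz_ineq2[of "fst \<eta>" w] abs_quadratic_form_le[of w "snd \<eta>"]
  unfolding etmn_exponent_def by linarith

lemma borel_measurable_etmn_exponent [measurable]:
  "etmn_exponent \<omega> \<in> borel_measurable borel"
proof -
  have "continuous_on UNIV (\<lambda>w. fst \<omega> \<bullet> w - w \<bullet> (snd \<omega> *v w))"
    by (intro continuous_intros linear_continuous_on matrix_vector_mul_bounded_linear)
  then show ?thesis
    unfolding etmn_exponent_def[abs_def] by (rule borel_measurable_continuous_onI)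
qed

section \<open>Integrals over the orthant\<close>

lemma sets_nonneg_orthant [measurable]: "(nonneg_orthant :: (real ^ 'n) set) \<in> sets borel"
proof -
  have "closed (nonneg_orthant :: (real ^ 'n) set)"
    unfolding nonneg_orthant_def by (intro closed_Collect_all closed_Collect_le continuous_intros)
  then show ?thesis by (rule borel_closed)
qed

lemma nn_integral_prod_cart:
  fixes f :: "real \<Rightarrow> ennreal"
  assumes [measurable]: "f \<in> borel_measurable borel"
  shows "(\<integral>\<^sup>+x. (\<Prod>i\<in>UNIV. f (x $ i)) \<partial>(lborel :: (real ^ 'n) measure))
    = (\<integral>\<^sup>+x. f x \<partial>lborel) ^ CARD('n)"
proof -
  have inj: "inj (\<lambda>i::'n. axis i (1::real))"
    by (simp add: inj_on_def axis_eq_axis)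
  have B: "(Basis :: (real ^ 'n) set) = range (\<lambda>i. axis i 1)"
    by (auto simp: Basis_vec_def)
  have "(\<integral>\<^sup>+x. (\<Prod>b\<in>Basis. f (x \<bullet> b)) \<partial>(lborel :: (real ^ 'n) measure))
      = (\<Prod>b\<in>(Basis::(real ^ 'n) set). \<integral>\<^sup>+x. f x \<partial>lborel)"
    by (rule nn_integral_lborel_prod) auto
  then show ?thesis
    by (simp add: B prod.reindex[OF inj] cart_eq_inner_axis card_image[OF inj])
qed

lemma indicator_nonneg_orthant:
  "indicator nonneg_orthant w = (\<Prod>i\<in>UNIV. indicator {0..} (w $ i) :: ennreal)"
  by (auto simp: nonneg_orthant_def indicator_def)

text \<open>The indicator of the orthant is a product of indicators of half-lines, each of infinite length.\<close>

lemma emeasure_nonneg_orthant: "emeasure lborel (nonneg_orthant :: (real ^ 'n) set) = \<infinity>"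
proof -
  have "emeasure lborel {0::real..} = \<infinity>"
  proof (rule ccontr)
    assume "emeasure lborel {0::real..} \<noteq> \<infinity>"
    then obtain r where r: "emeasure lborel {0::real..} = ennreal r" "0 \<le> r"
      by (cases "emeasure lborel {0::real..}") auto
    have "emeasure lborel {0..r + 1} \<le> emeasure lborel {0::real..}"
      by (intro emeasure_mono) auto
    then show False using r by simp
  qed
  moreover have "emeasure lborel (nonneg_orthant :: (real ^ 'n) set)
      = (\<integral>\<^sup>+w. (\<Prod>i\<in>UNIV. indicator {0..} (w $ i)) \<partial>(lborel :: (real ^ 'n) measure))"
    by (simp flip: indicator_nonneg_orthant)
  ultimately show ?thesis
    by (simp add: nn_integral_prod_cart[where f = "indicator {0..}"] power_eq_top_ennreal)
qed

text \<open>The integrand is a product over the coordinates, so the integral is the \<open>d\<close>-th power of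
  \<open>\<integral>\<^sub>0\<^sup>\<infinity> exp (- c x) dx = 1 / c\<close>.\<close>

lemma nn_integral_exp_sum_orthant:
  assumes "0 < c"
  shows "(\<integral>\<^sup>+w\<in>nonneg_orthant. ennreal (exp (- c * (\<Sum>i\<in>UNIV. w $ i))) \<partial>(lborel :: (real ^ 'n) measure)) < \<infinity>"
proof -
  have "(\<integral>\<^sup>+x. ennreal (exp (- c * x)) * indicator {0..} x \<partial>lborel) = ennreal (0 - - exp (- c * 0) / c)"
  proof (rule nn_integral_FTC_atLeast)
    fix x :: real
    show "DERIV (\<lambda>x. - exp (- c * x) / c) x :> exp (- c * x)"
      using assms by (auto intro!: derivative_eq_intros)
    show "((\<lambda>x. - exp (- c * x) / c) \<longlongrightarrow> 0) at_top"
      using assms by real_asymp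
  qed auto
  then have "(\<integral>\<^sup>+x. ennreal (exp (- c * x)) * indicator {0..} x \<partial>lborel) < \<infinity>"
    by (simp only: ennreal_less_top infinity_ennreal_def)
  moreover have "ennreal (exp (- c * (\<Sum>i\<in>UNIV. w $ i))) * indicator nonneg_orthant w
      = (\<Prod>i\<in>UNIV. ennreal (exp (- c * w $ i)) * indicator {0..} (w $ i))" for w :: "real ^ 'n"
    by (simp add: indicator_nonneg_orthant prod.distrib prod_ennreal sum_distrib_left flip: exp_sum sum_negf)
  ultimately show ?thesis
    by (simp add: power_less_top_ennreal
        nn_integral_prod_cart[where f = "\<lambda>x. ennreal (exp (- (c * x))) * indicator {0..} x"])
qed

section \<open>The partition function\<close>

definition etmn_weight :: "'n::finite param \<Rightarrow> real ^ 'n \<Rightarrow> real" where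
  "etmn_weight \<omega> w = indicator nonneg_orthant w * exp (etmn_exponent \<omega> w)"

lemma borel_measurable_etmn_weight [measurable]:
  "etmn_weight \<omega> \<in> borel_measurable borel"
  unfolding etmn_weight_def[abs_def] by measurable

lemma etmn_weight_nonneg: "0 \<le> etmn_weight \<omega> w"
  by (simp add: etmn_weight_def)

lemma etmn_weight_add:
  "etmn_weight (\<omega> + h *\<^sub>R \<eta>) w = exp (h * etmn_exponent \<eta> w) * etmn_weight \<omega> w"
  by (simp add: etmn_weight_def etmn_exponent_add etmn_exponent_scaleR exp_add mult_ac)

lemma etmn_L_eq_nn_integral: "etmn_L \<omega> = (\<integral>\<^sup>+w. ennreal (etmn_weight \<omega> w) \<partial>lborel)"
  unfolding etmn_L_def etmn_weight_def
  by (intro nn_integral_cong) (auto simp: indicator_def)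

lemma enn2real_etmn_L: "enn2real (etmn_L \<omega>) = (\<integral>w. etmn_weight \<omega> w \<partial>lborel)"
  unfolding etmn_L_eq_nn_integral
  by (rule integral_eq_nn_integral[symmetric]) (auto simp: etmn_weight_nonneg)

lemma integrable_etmn_weight:
  assumes "etmn_L \<omega> < \<infinity>"
  shows "integrable lborel (etmn_weight \<omega>)"
  using assms unfolding etmn_L_eq_nn_integral
  by (intro integrableI_nonneg) (auto simp: etmn_weight_nonneg)

lemma etmn_L_mono:
  assumes "\<And>w. w \<in> nonneg_orthant \<Longrightarrow> etmn_exponent \<omega> w \<le> etmn_exponent \<omega>' w"
  shows "etmn_L \<omega> \<le> etmn_L \<omega>'"
  unfolding etmn_L_def using assms
  by (intro nn_integral_mono) (auto simp: indicator_def intro!: ennreal_leI)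

text \<open>A positive function on a set of positive measure has a positive integral. Positivity is what
  makes the logarithm \<open>K\<^sub>T\<close> meaningful and differentiable.\<close>

lemma etmn_L_pos: "0 < etmn_L (\<omega> :: 'n::finite param)"
proof (rule ccontr)
  assume "\<not> 0 < etmn_L \<omega>"
  then have "(\<integral>\<^sup>+w. ennreal (etmn_weight \<omega> w) \<partial>lborel) = 0"
    by (simp add: etmn_L_eq_nn_integral)
  then have "AE w in lborel. ennreal (etmn_weight \<omega> w) = 0"
    by (subst (asm) nn_integral_0_iff_AE) auto
  then have "AE w in lborel. w \<notin> (nonneg_orthant :: (real ^ 'n) set)"
    by eventually_elim (auto simp: etmn_weight_def split: split_indicator_asm)
  then have "emeasure lborel (nonneg_orthant :: (real ^ 'n) set) = 0"
    by (subst (asm) AE_iff_measurable[OF _ refl]) auto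
  then show False
    by (simp add: emeasure_nonneg_orthant)
qed

section \<open>Differentiation under the integral\<close>

lemma abs_exp_minus_one_le: "\<bar>exp t - 1\<bar> \<le> \<bar>t\<bar> * exp \<bar>t\<bar>" for t :: real
proof (cases "0 \<le> t")
  case True
  have "exp t * (1 - t) \<le> exp t * exp (- t)"
    using exp_ge_add_one_self[of "- t"] by (intro mult_left_mono) auto
  then show ?thesis using True by (simp add: exp_minus algebra_simps)
next
  case False
  have "1 - exp t \<le> - t"
    using exp_ge_add_one_self[of t] by linarith
  also have "\<dots> \<le> - t * exp (- t)"
    using False by (simp add: mult_le_cancel_left1)
  finally show ?thesis using False by (simp add: abs_if)
qed

text \<open>The integral is the moment generating function of \<open>s\<close> under the density \<open>g\<close>. Dominated
  convergence applies to its difference quotients at \<open>0\<close>: for \<open>\<bar>h\<bar> \<le> \<delta>/2\<close> those of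
  \<open>exp (h s)\<close> are at most \<open>\<bar>s\<bar> exp (\<delta>/2 \<bar>s\<bar>)\<close>, and the factor \<open>\<bar>s\<bar>\<close> is absorbed
  by the other half of the exponent.\<close>

lemma has_real_derivative_exp_integral:
  fixes g s :: "'a \<Rightarrow> real"
  assumes [measurable]: "g \<in> borel_measurable M" "s \<in> borel_measurable M"
    and g: "\<And>x. 0 \<le> g x" and \<delta>: "0 < \<delta>"
    and int: "integrable M (\<lambda>x. exp (\<delta> * \<bar>s x\<bar>) * g x)"
  shows "((\<lambda>h. \<integral>x. exp (h * s x) * g x \<partial>M) has_real_derivative (\<integral>x. s x * g x \<partial>M)) (at 0)"
proof -
  define q where "q h x = (exp (h * s x) - 1) / h * g x" for h x
  define D where "D x = 2 / \<delta> * (exp (\<delta> * \<bar>s x\<bar>) * g x)" for x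
  have integrable: "integrable M (\<lambda>x. exp (h * s x) * g x)" if "\<bar>h\<bar> \<le> \<delta>" for h
  proof (rule Bochner_Integration.integrable_bound[OF int])
    have "h * s x \<le> \<delta> * \<bar>s x\<bar>" for x
      using mult_right_mono[OF that, of "\<bar>s x\<bar>"] by (simp add: abs_mult[symmetric])
    then show "AE x in M. norm (exp (h * s x) * g x) \<le> norm (exp (\<delta> * \<bar>s x\<bar>) * g x)"
      by (auto intro!: mult_right_mono simp: g)
  qed simp
  have bound: "\<bar>q h x\<bar> \<le> D x" if h: "\<bar>h\<bar> \<le> \<delta> / 2" "h \<noteq> 0" for h x
  proof -
    have "\<bar>(exp (h * s x) - 1) / h\<bar> \<le> \<bar>h * s x\<bar> * exp \<bar>h * s x\<bar> / \<bar>h\<bar>"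
      unfolding abs_divide by (intro divide_right_mono abs_exp_minus_one_le) auto
    also have "\<dots> = \<bar>s x\<bar> * exp (\<bar>h\<bar> * \<bar>s x\<bar>)"
      using h by (simp add: abs_mult)
    also have "\<dots> \<le> (2 / \<delta> * exp (\<delta> / 2 * \<bar>s x\<bar>)) * exp (\<delta> / 2 * \<bar>s x\<bar>)"
    proof (intro mult_mono)
      have "\<delta> / 2 * \<bar>s x\<bar> \<le> exp (\<delta> / 2 * \<bar>s x\<bar>)"
        using exp_ge_add_one_self[of "\<delta> / 2 * \<bar>s x\<bar>"] by linarith
      then show "\<bar>s x\<bar> \<le> 2 / \<delta> * exp (\<delta> / 2 * \<bar>s x\<bar>)"
        using \<delta> by (simp add: field_simps)
      show "exp (\<bar>h\<bar> * \<bar>s x\<bar>) \<le> exp (\<delta> / 2 * \<bar>s x\<bar>)"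
        using mult_right_mono[OF h(1), of "\<bar>s x\<bar>"] by simp
    qed (use \<delta> in auto)
    also have "\<dots> = 2 / \<delta> * exp (\<delta> * \<bar>s x\<bar>)"
      by (simp flip: exp_add)
    finally show ?thesis
      using mult_right_mono[OF _ g[of x]] by (fastforce simp: q_def D_def abs_mult g mult.assoc)
  qed
  have "(\<lambda>h. \<integral>x. q h x \<partial>M) \<midarrow>0\<rightarrow> (\<integral>x. s x * g x \<partial>M)"
    unfolding tendsto_at_iff_sequentially comp_def
  proof (intro allI impI)
    fix X :: "nat \<Rightarrow> real"
    assume X: "\<forall>i. X i \<in> UNIV - {0}" "X \<longlonglongrightarrow> 0"
    have "eventually (\<lambda>n. \<bar>X n\<bar> < \<delta> / 2) sequentially"
      using tendstoD[OF X(2), of "\<delta> / 2"] \<delta> by (simp add: dist_real_def)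
    then obtain N where N: "\<And>n. \<bar>X (n + N)\<bar> \<le> \<delta> / 2"
      unfolding eventually_sequentially by (meson le_add2 less_imp_le)
    have "(\<lambda>n. \<integral>x. q (X (n + N)) x \<partial>M) \<longlonglongrightarrow> (\<integral>x. s x * g x \<partial>M)"
    proof (rule integral_dominated_convergence[where w = D])
      show "integrable M D"
        unfolding D_def by (intro integrable_mult_right int)
      show "AE x in M. norm (q (X (n + N)) x) \<le> D x" for n
        using bound[OF N[of n]] X(1) by auto
      show "AE x in M. (\<lambda>n. q (X (n + N)) x) \<longlonglongrightarrow> s x * g x"
      proof (rule AE_I2)
        fix x
        have "((\<lambda>h. exp (h * s x)) has_real_derivative s x) (at 0)"
          by (auto intro!: derivative_eq_intros)
        then have "(\<lambda>h. q h x) \<midarrow>0\<rightarrow> s x * g x"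
          unfolding q_def DERIV_def by (intro tendsto_intros) simp
        then have "(\<lambda>n. q (X n) x) \<longlonglongrightarrow> s x * g x"
          using X unfolding tendsto_at_iff_sequentially comp_def by blast
        then show "(\<lambda>n. q (X (n + N)) x) \<longlonglongrightarrow> s x * g x"
          by (rule LIMSEQ_ignore_initial_segment)
      qed
    qed (unfold q_def, measurable)
    then show "(\<lambda>n. \<integral>x. q (X n) x \<partial>M) \<longlonglongrightarrow> (\<integral>x. s x * g x \<partial>M)"
      by (rule LIMSEQ_offset)
  qed
  moreover have "eventually (\<lambda>h. (\<integral>x. q h x \<partial>M)
      = ((\<integral>x. exp (h * s x) * g x \<partial>M) - (\<integral>x. exp (0 * s x) * g x \<partial>M)) / h) (at 0)"
    unfolding eventually_at
  proof (intro exI conjI ballI impI)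
    fix h :: real
    assume h: "h \<noteq> 0 \<and> dist h 0 < \<delta>"
    have "(\<integral>x. q h x \<partial>M) = (\<integral>x. (exp (h * s x) * g x - exp (0 * s x) * g x) / h \<partial>M)"
      by (intro Bochner_Integration.integral_cong) (simp_all add: q_def algebra_simps diff_divide_distrib)
    also have "\<dots> = ((\<integral>x. exp (h * s x) * g x \<partial>M) - (\<integral>x. exp (0 * s x) * g x \<partial>M)) / h"
      using integrable[of h] integrable[of 0] h \<delta> by (simp add: dist_real_def)
    finally show "(\<integral>x. q h x \<partial>M)
      = ((\<integral>x. exp (h * s x) * g x \<partial>M) - (\<integral>x. exp (0 * s x) * g x \<partial>M)) / h" .
  qed (fact \<delta>)
  ultimately show ?thesis
    unfolding DERIV_def add_0 by (rule Lim_transform_eventually)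
qed

text \<open>The exponent is linear in the parameter, so moving the parameter along \<open>\<eta>\<close> tilts the weight
  exponentially. The derivative is the expectation of the statistic in direction \<open>\<eta>\<close>. The
  parameter \<open>\<omega>'\<close> serves only to dominate both tilts by \<open>\<plusminus> \<delta>\<close>.\<close>

lemma has_real_derivative_etmn_K:
  fixes \<omega> \<eta> :: "'n::finite param"
  assumes \<delta>: "0 < \<delta>" and fin: "etmn_L \<omega>' < \<infinity>"
    and le: "\<And>w. w \<in> nonneg_orthant \<Longrightarrow>
      etmn_exponent \<omega> w + \<delta> * \<bar>etmn_exponent \<eta> w\<bar> \<le> etmn_exponent \<omega>' w"
  shows "((\<lambda>h. etmn_K (\<omega> + h *\<^sub>R \<eta>)) has_real_derivative
    (\<integral>w. etmn_exponent \<eta> w * etmn_weight \<omega> w \<partial>lborel) / enn2real (etmn_L \<omega>)) (at 0)"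
proof -
  let ?s = "etmn_exponent \<eta>" and ?g = "etmn_weight \<omega>"
  have "integrable lborel (\<lambda>w. exp (\<delta> * \<bar>?s w\<bar>) * ?g w)"
  proof (rule Bochner_Integration.integrable_bound[OF integrable_etmn_weight[OF fin]])
    show "AE w in lborel. norm (exp (\<delta> * \<bar>?s w\<bar>) * ?g w) \<le> norm (etmn_weight \<omega>' w)"
    proof (rule AE_I2)
      fix w
      show "norm (exp (\<delta> * \<bar>?s w\<bar>) * ?g w) \<le> norm (etmn_weight \<omega>' w)"
        using le[of w]
        by (cases "w \<in> nonneg_orthant") (simp_all add: etmn_weight_def add.commute flip: exp_add)
    qed
  qed simp
  then have deriv: "((\<lambda>h. \<integral>w. exp (h * ?s w) * ?g w \<partial>lborel) has_real_derivative
      (\<integral>w. ?s w * ?g w \<partial>lborel)) (at 0)"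
    by (intro has_real_derivative_exp_integral[OF _ _ _ \<delta>]) (auto simp: etmn_weight_nonneg)
  have "etmn_L \<omega> \<le> etmn_L \<omega>'"
  proof (rule etmn_L_mono)
    fix w :: "real ^ 'n" assume "w \<in> nonneg_orthant"
    moreover have "0 \<le> \<delta> * \<bar>etmn_exponent \<eta> w\<bar>" using \<delta> by simp
    ultimately show "etmn_exponent \<omega> w \<le> etmn_exponent \<omega>' w"
      using le[of w] by linarith
  qed
  then have pos: "0 < enn2real (etmn_L \<omega>)"
    using fin etmn_L_pos[of \<omega>] by (auto simp: enn2real_positive_iff)
  have "((\<lambda>h. ln (\<integral>w. exp (h * ?s w) * ?g w \<partial>lborel)) has_real_derivative
      1 / (\<integral>w. exp (0 * ?s w) * ?g w \<partial>lborel) * (\<integral>w. ?s w * ?g w \<partial>lborel)) (at 0)"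
    by (rule DERIV_chain2[OF DERIV_ln_divide deriv]) (use pos in \<open>simp add: enn2real_etmn_L\<close>)
  then show ?thesis
    by (simp add: etmn_K_def enn2real_etmn_L etmn_weight_add)
qed

section \<open>Isotropic parameters\<close>

definition isotropic :: "real \<Rightarrow> real \<Rightarrow> 'n::finite param" where
  "isotropic c \<epsilon> = (- (c *\<^sub>R 1), \<epsilon> *\<^sub>R mat 1)"

lemma etmn_exponent_isotropic:
  "etmn_exponent (isotropic c \<epsilon>) w = - c * (\<Sum>i\<in>UNIV. w $ i) - \<epsilon> * (norm w)\<^sup>2"
proof -
  have "- (c *\<^sub>R 1) \<bullet> w = - c * (\<Sum>i\<in>UNIV. w $ i)"
    by (simp add: inner_vec_def sum_distrib_left sum_negf)
  moreover have "w \<bullet> ((\<epsilon> *\<^sub>R mat 1) *v w) = \<epsilon> * (norm w)\<^sup>2"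
    by (simp add: power2_norm_eq_inner flip: scaleR_matrix_vector_assoc)
  ultimately show ?thesis
    by (simp add: etmn_exponent_def isotropic_def)
qed

lemma power2_norm_cart: "(norm w)\<^sup>2 = (\<Sum>i\<in>UNIV. (w $ i)\<^sup>2)" for w :: "real ^ 'n"
  by (simp add: norm_vec_def L2_set_def sum_nonneg)

lemma etmn_exponent_isotropic_sum:
  "etmn_exponent (isotropic c \<epsilon>) w = (\<Sum>i\<in>UNIV. - c * w $ i - \<epsilon> * (w $ i)\<^sup>2)"
  by (simp add: etmn_exponent_isotropic power2_norm_cart sum_subtractf sum_distrib_left)

lemma norm_le_sum_orthant:
  assumes "w \<in> nonneg_orthant"
  shows "norm w \<le> (\<Sum>i\<in>UNIV. w $ i)"
  using norm_le_l1_cart[of w] assms by (simp add: nonneg_orthant_def)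

lemma etmn_L_isotropic_finite:
  assumes "0 < c"
  shows "etmn_L (isotropic c 0 :: 'n::finite param) < \<infinity>"
  using nn_integral_exp_sum_orthant[OF assms, where 'n = 'n]
  by (simp add: etmn_L_def etmn_exponent_isotropic)

text \<open>Completing the square bounds each coordinate's contribution to the exponent from below, so the
  integrand is bounded below by a positive constant on a set of infinite measure.\<close>

lemma etmn_L_isotropic_infinite:
  assumes "\<epsilon> < 0"
  shows "etmn_L (isotropic c \<epsilon> :: 'n::finite param) = \<infinity>"
proof -
  define m where "m = - (CARD('n) * (c\<^sup>2 / (- 4 * \<epsilon>)))"
  have "m \<le> etmn_exponent (isotropic c \<epsilon>) w" for w :: "real ^ 'n"
  proof -
    have "- (c\<^sup>2 / (- 4 * \<epsilon>)) \<le> - c * x - \<epsilon> * x\<^sup>2" for x :: real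
    proof -
      \<comment> \<open>the parabola with its minimum value \<open>- c\<^sup>2 / (- 4 \<epsilon>)\<close> subtracted\<close>
      have "0 \<le> (2 * \<epsilon> * x + c)\<^sup>2 / (- 4 * \<epsilon>)"
        using assms by (intro divide_nonneg_pos) auto
      also have "\<dots> = - c * x - \<epsilon> * x\<^sup>2 + c\<^sup>2 / (- 4 * \<epsilon>)"
        using assms by (simp add: power2_eq_square field_simps)
      finally show ?thesis by simp
    qed
    then have "(\<Sum>i\<in>(UNIV::'n set). - (c\<^sup>2 / (- 4 * \<epsilon>))) \<le> (\<Sum>i\<in>UNIV. - c * w $ i - \<epsilon> * (w $ i)\<^sup>2)"
      by (intro sum_mono) auto
    also have "\<dots> = etmn_exponent (isotropic c \<epsilon>) w"
      by (simp add: etmn_exponent_isotropic_sum)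
    finally show ?thesis by (simp add: m_def)
  qed
  then have "(\<integral>\<^sup>+w\<in>nonneg_orthant. ennreal (exp m) \<partial>(lborel :: (real ^ 'n) measure))
      \<le> etmn_L (isotropic c \<epsilon> :: 'n param)"
    unfolding etmn_L_def
    by (intro nn_integral_mono mult_right_mono ennreal_leI) auto
  then show ?thesis
    by (simp add: nn_integral_cmult emeasure_nonneg_orthant ennreal_mult_top top_unique)
qed

text \<open>A perturbation of size less than \<open>c/2\<close> in \<open>\<theta>\<close> and less than \<open>\<epsilon>\<close> in \<open>\<Theta>\<close> costs at most half of
  the linear decay and all of the quadratic decay. The remaining half of the linear decay suffices
  for integrability.\<close>

lemma isotropic_in_interior:
  assumes c: "0 < c" and \<epsilon>: "0 < \<epsilon>"
  shows "(isotropic c \<epsilon> :: 'n::finite param) \<in> param_top interior_of etmn_D"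
proof -
  define U :: "'n param set" where "U = ball (- (c *\<^sub>R 1)) (c / 2) \<times> ball (\<epsilon> *\<^sub>R mat 1) \<epsilon>"
  define W where "W = U \<inter> (UNIV \<times> sym_mats)"
  have "openin param_top W"
    unfolding param_top_def W_def
    by (subst Int_commute) (intro openin_open_Int, simp add: U_def open_Times)
  moreover have "W \<subseteq> etmn_D"
  proof
    fix \<omega> assume "\<omega> \<in> W"
    then obtain \<theta> \<Theta> where \<omega>: "\<omega> = (\<theta>, \<Theta>)" "\<Theta> \<in> sym_mats"
      and \<theta>: "norm (- (c *\<^sub>R 1) - \<theta>) < c / 2" and \<Theta>: "norm (\<epsilon> *\<^sub>R mat 1 - \<Theta>) < \<epsilon>"
      by (auto simp: W_def U_def dist_norm)
    have "etmn_L \<omega> \<le> etmn_L (isotropic (c / 2) 0 :: 'n param)"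
    proof (rule etmn_L_mono)
      fix w :: "real ^ 'n" assume w: "w \<in> nonneg_orthant"
      let ?\<eta> = "(\<theta> + c *\<^sub>R 1, \<Theta> - \<epsilon> *\<^sub>R mat 1)"
      let ?\<sigma> = "\<Sum>i\<in>UNIV. w $ i"
      have "etmn_exponent \<omega> w = etmn_exponent (isotropic c \<epsilon>) w + etmn_exponent ?\<eta> w"
        by (simp add: \<omega> isotropic_def flip: etmn_exponent_add)
      moreover have "\<bar>etmn_exponent ?\<eta> w\<bar> \<le> c / 2 * norm w + \<epsilon> * (norm w)\<^sup>2"
      proof (rule order_trans[OF abs_etmn_exponent_le], intro add_mono mult_right_mono)
        have "norm (\<theta> + c *\<^sub>R 1) = norm (- (c *\<^sub>R 1) - \<theta>)"
          by (subst norm_minus_cancel[symmetric]) (simp add: algebra_simps)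
        with \<theta> show "norm (fst ?\<eta>) \<le> c / 2" by simp
        show "norm (snd ?\<eta>) \<le> \<epsilon>" using \<Theta> by (simp add: norm_minus_commute)
      qed auto
      moreover have "c / 2 * norm w \<le> c / 2 * ?\<sigma>"
        using c norm_le_sum_orthant[OF w] by (intro mult_left_mono) auto
      ultimately show "etmn_exponent \<omega> w \<le> etmn_exponent (isotropic (c / 2) 0) w"
        unfolding etmn_exponent_isotropic by simp
    qed
    also have "\<dots> < \<infinity>"
      using c by (intro etmn_L_isotropic_finite) simp
    finally show "\<omega> \<in> etmn_D"
      using \<omega> by (simp add: etmn_D_def)
  qed
  moreover have "isotropic c \<epsilon> \<in> W"
    using c \<epsilon> by (auto simp: W_def U_def isotropic_def sym_mats_def transpose_def vec_eq_iff mat_def)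
  ultimately show ?thesis
    by (meson interior_of_maximal subsetD)
qed

lemma isotropic_tendsto:
  assumes "(f \<longlongrightarrow> \<epsilon>) F"
  shows "((\<lambda>x. isotropic c (f x) :: 'n::finite param) \<longlongrightarrow> isotropic c \<epsilon>) F"
  unfolding isotropic_def by (intro tendsto_intros assms)

text \<open>The point is a limit of the interior points with \<open>\<epsilon> = 1/(n+1)\<close> and of the points with
  \<open>\<epsilon> = -1/(n+1)\<close>, which lie outside the parameter space.\<close>

lemma isotropic_in_frontier:
  assumes c: "0 < c"
  shows "(isotropic c 0 :: 'n::finite param) \<in> param_top frontier_of (param_top interior_of etmn_D)"
proof -
  let ?I = "param_top interior_of (etmn_D :: 'n param set)"
  let ?S = "UNIV \<times> sym_mats :: 'n param set"
  have sym: "isotropic c \<epsilon> \<in> ?S" for \<epsilon>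
    by (auto simp: isotropic_def sym_mats_def transpose_def vec_eq_iff mat_def)
  have "isotropic c 0 \<in> param_top closure_of ?I"
    unfolding in_closure_of
  proof (intro conjI allI impI)
    show "isotropic c 0 \<in> topspace (param_top :: 'n param topology)"
      using sym by (simp add: param_top_def)
    fix T :: "'n param set"
    assume T: "isotropic c 0 \<in> T \<and> openin param_top T"
    then obtain V where V: "open V" "T = ?S \<inter> V"
      by (auto simp: param_top_def openin_open)
    with T have "eventually (\<lambda>n. isotropic c (inverse (real (Suc n))) \<in> V) sequentially"
      by (intro topological_tendstoD[OF isotropic_tendsto[OF LIMSEQ_inverse_real_of_nat]]) auto
    then obtain n where "isotropic c (inverse (real (Suc n))) \<in> V"
      by (auto simp: eventually_sequentially)
    then show "\<exists>y. y \<in> ?I \<and> y \<in> T"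
      using isotropic_in_interior[OF c, of "inverse (real (Suc n))", where 'n = 'n] sym V
      by (intro exI[of _ "isotropic c (inverse (real (Suc n)))"]) simp
  qed
  moreover have "isotropic c 0 \<notin> ?I"
  proof
    assume "isotropic c 0 \<in> ?I"
    moreover have "openin param_top ?I" by (rule openin_interior_of)
    then obtain V where V: "open V" "?I = ?S \<inter> V"
      unfolding param_top_def openin_open by blast
    ultimately have "isotropic c 0 \<in> V" by blast
    have "(\<lambda>n. isotropic c (- inverse (real (Suc n))) :: 'n param) \<longlonglongrightarrow> isotropic c (- 0)"
      by (intro isotropic_tendsto tendsto_minus LIMSEQ_inverse_real_of_nat)
    then have "eventually (\<lambda>n. isotropic c (- inverse (real (Suc n))) \<in> V) sequentially"
      by (rule topological_tendstoD) (simp_all add: V(1) \<open>isotropic c 0 \<in> V\<close>)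
    then obtain n where "isotropic c (- inverse (real (Suc n))) \<in> V"
      by (auto simp: eventually_sequentially)
    then have "isotropic c (- inverse (real (Suc n))) \<in> ?I"
      unfolding V(2) using sym by blast
    then have "isotropic c (- inverse (real (Suc n))) \<in> (etmn_D :: 'n param set)"
      by (rule subsetD[OF interior_of_subset])
    then show False
      using etmn_L_isotropic_infinite[of "- inverse (real (Suc n))" c, where 'n = 'n]
      by (simp add: etmn_D_def)
  qed
  ultimately show ?thesis
    by (simp add: frontier_of_def)
qed

section \<open>Boundedness of the gradient\<close>

text \<open>An upper bound, up to the size of the direction, for the quotient of the largest possible
  numerator by the smallest possible denominator in the directional derivatives of \<open>K\<^sub>T\<close>. The
  factor \<open>16\<close> comes from bounding a quadratic by an exponential below.\<close>

definition gradient_bound :: "'n::finite itself \<Rightarrow> real" where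
  "gradient_bound _ = 16 * enn2real (etmn_L (isotropic (1 / 2) 0 :: 'n param))
     / enn2real (etmn_L (isotropic 1 1 :: 'n param))"

text \<open>With \<open>\<sigma> = \<Sum>\<^sub>i w\<^sub>i\<close>, the inequality \<open>x \<le> exp x\<close> at \<open>\<sigma>/2\<close> and at \<open>\<sigma>/4\<close> gives
  \<open>\<sigma> \<le> 2 exp (\<sigma>/2)\<close> and \<open>\<sigma>\<^sup>2 \<le> 16 exp (\<sigma>/2)\<close>. Half of
  the decay \<open>exp (- \<sigma>)\<close> is thus left over for integrability.\<close>

lemma abs_etmn_exponent_le_exp:
  assumes w: "w \<in> nonneg_orthant"
  shows "\<bar>etmn_exponent \<eta> w\<bar> \<le> 16 * (norm (fst \<eta>) + norm (snd \<eta>)) * exp (1 / 2 * (\<Sum>i\<in>UNIV. w $ i))"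
proof -
  let ?\<sigma> = "\<Sum>i\<in>UNIV. w $ i"
  have nw: "norm w \<le> ?\<sigma>" by (rule norm_le_sum_orthant[OF w])
  then have \<sigma>: "0 \<le> ?\<sigma>" using norm_ge_zero[of w] by linarith
  have e: "?\<sigma> / 4 \<le> exp (?\<sigma> / 4)"
    using exp_ge_add_one_self[of "?\<sigma> / 4"] by linarith
  have "?\<sigma> / 2 \<le> exp (1 / 2 * ?\<sigma>)"
    using exp_ge_add_one_self[of "1 / 2 * ?\<sigma>"] by linarith
  then have 1: "norm w \<le> 16 * exp (1 / 2 * ?\<sigma>)"
    using nw exp_gt_zero[of "1 / 2 * ?\<sigma>"] by linarith
  have "(?\<sigma> / 4)\<^sup>2 \<le> (exp (?\<sigma> / 4))\<^sup>2"
    using e \<sigma> by (intro power_mono) auto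
  also have "(exp (?\<sigma> / 4))\<^sup>2 = exp (1 / 2 * ?\<sigma>)"
    by (simp add: power2_eq_square flip: exp_add)
  finally have "?\<sigma>\<^sup>2 \<le> 16 * exp (1 / 2 * ?\<sigma>)"
    by (simp add: power_divide)
  moreover have "(norm w)\<^sup>2 \<le> ?\<sigma>\<^sup>2"
    using nw by (intro power_mono) auto
  ultimately have 2: "(norm w)\<^sup>2 \<le> 16 * exp (1 / 2 * ?\<sigma>)"
    using exp_gt_zero[of "1 / 2 * ?\<sigma>"] by linarith
  have "\<bar>etmn_exponent \<eta> w\<bar> \<le> norm (fst \<eta>) * norm w + norm (snd \<eta>) * (norm w)\<^sup>2"
    by (rule abs_etmn_exponent_le)
  also have "\<dots> \<le> norm (fst \<eta>) * (16 * exp (1 / 2 * ?\<sigma>)) + norm (snd \<eta>) * (16 * exp (1 / 2 * ?\<sigma>))"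
    using 1 2 by (intro add_mono mult_left_mono) auto
  finally show ?thesis by (simp add: algebra_simps)
qed

text \<open>The numerator is dominated by the weight with half the linear decay and no quadratic decay, the
  denominator is smallest for \<open>\<epsilon> = 1\<close>, and neither estimate depends on \<open>\<epsilon>\<close>.\<close>

lemma abs_deriv_etmn_K_le:
  fixes \<eta> :: "'n::finite param"
  assumes \<epsilon>: "0 < \<epsilon>" "\<epsilon> \<le> 1"
  shows "\<bar>deriv (\<lambda>h. etmn_K (isotropic 1 \<epsilon> + h *\<^sub>R \<eta>)) 0\<bar>
    \<le> gradient_bound TYPE('n) * (norm (fst \<eta>) + norm (snd \<eta>))"
proof -
  let ?\<omega> = "isotropic 1 \<epsilon> :: 'n param"
  let ?\<sigma> = "\<lambda>w :: real ^ 'n. \<Sum>i\<in>UNIV. w $ i"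
  define N where "N = norm (fst \<eta>) + norm (snd \<eta>)"
  define \<delta> where "\<delta> = min (1 / 2) \<epsilon> / (N + 1)"
  \<comment> \<open>\<open>\<delta>\<close> is so small that the tilted exponent keeps half of its linear decay; it may depend on
    \<open>\<epsilon>\<close>, as it does not enter the bound. The \<open>+ 1\<close> covers \<open>\<eta> = 0\<close>.\<close>
  have N: "0 \<le> N" by (simp add: N_def)
  have \<delta>: "0 < \<delta>" using \<epsilon> N by (simp add: \<delta>_def)
  have fin: "etmn_L (isotropic (1 / 2) 0 :: 'n param) < \<infinity>"
    by (intro etmn_L_isotropic_finite) simp
  have dN: "\<delta> * N \<le> min (1 / 2) \<epsilon>"
  proof -
    have "\<delta> * N = min (1 / 2) \<epsilon> * (N / (N + 1))" by (simp add: \<delta>_def)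
    also have "\<dots> \<le> min (1 / 2) \<epsilon> * 1"
      using N \<epsilon> by (intro mult_left_mono) auto
    finally show ?thesis by simp
  qed
  have deriv: "deriv (\<lambda>h. etmn_K (?\<omega> + h *\<^sub>R \<eta>)) 0
      = (\<integral>w. etmn_exponent \<eta> w * etmn_weight ?\<omega> w \<partial>lborel) / enn2real (etmn_L ?\<omega>)"
  proof (rule DERIV_imp_deriv, rule has_real_derivative_etmn_K[OF \<delta> fin])
    fix w :: "real ^ 'n" assume w: "w \<in> nonneg_orthant"
    have nw: "norm w \<le> ?\<sigma> w" by (rule norm_le_sum_orthant[OF w])
    have "\<bar>etmn_exponent \<eta> w\<bar> \<le> norm (fst \<eta>) * norm w + norm (snd \<eta>) * (norm w)\<^sup>2"
      by (rule abs_etmn_exponent_le)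
    also have "\<dots> \<le> N * norm w + N * (norm w)\<^sup>2"
      by (intro add_mono mult_right_mono) (auto simp: N_def)
    finally have "\<delta> * \<bar>etmn_exponent \<eta> w\<bar> \<le> \<delta> * (N * norm w + N * (norm w)\<^sup>2)"
      using \<delta> by (intro mult_left_mono) auto
    also have "\<dots> = \<delta> * N * norm w + \<delta> * N * (norm w)\<^sup>2"
      by (simp add: algebra_simps)
    also have "\<dots> \<le> 1 / 2 * norm w + \<epsilon> * (norm w)\<^sup>2"
      using dN by (intro add_mono mult_right_mono) auto
    finally show "etmn_exponent ?\<omega> w + \<delta> * \<bar>etmn_exponent \<eta> w\<bar> \<le> etmn_exponent (isotropic (1 / 2) 0) w"
      using nw unfolding etmn_exponent_isotropic by simp
  qed
  have num: "\<bar>\<integral>w. etmn_exponent \<eta> w * etmn_weight ?\<omega> w \<partial>lborel\<bar>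
      \<le> 16 * N * enn2real (etmn_L (isotropic (1 / 2) 0 :: 'n param))"
  proof -
    have int: "integrable lborel (\<lambda>w :: real ^ 'n. 16 * N * etmn_weight (isotropic (1 / 2) 0) w)"
      using integrable_etmn_weight[OF fin] by simp
    have le: "\<bar>etmn_exponent \<eta> w * etmn_weight ?\<omega> w\<bar> \<le> 16 * N * etmn_weight (isotropic (1 / 2) 0) w" for w :: "real ^ 'n"
    proof (cases "w \<in> nonneg_orthant")
      case True
      have "\<bar>etmn_exponent \<eta> w * etmn_weight ?\<omega> w\<bar>
          \<le> (16 * N * exp (1 / 2 * ?\<sigma> w)) * exp (- ?\<sigma> w)"
        unfolding abs_mult N_def
      proof (intro mult_mono abs_etmn_exponent_le_exp True)
        show "\<bar>etmn_weight ?\<omega> w\<bar> \<le> exp (- ?\<sigma> w)"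
          using True \<epsilon> by (simp add: etmn_weight_def etmn_exponent_isotropic)
      qed auto
      also have "\<dots> = 16 * N * etmn_weight (isotropic (1 / 2) 0) w"
        using True by (simp add: etmn_weight_def etmn_exponent_isotropic flip: exp_add)
      finally show ?thesis .
    qed (simp add: etmn_weight_def)
    have "\<bar>\<integral>w. etmn_exponent \<eta> w * etmn_weight ?\<omega> w \<partial>lborel\<bar>
        \<le> (\<integral>w. 16 * N * etmn_weight (isotropic (1 / 2) 0 :: 'n param) w \<partial>lborel)"
    proof (rule order_trans[OF integral_abs_bound], rule integral_mono)
      show "integrable lborel (\<lambda>w. \<bar>etmn_exponent \<eta> w * etmn_weight ?\<omega> w\<bar>)"
        by (rule Bochner_Integration.integrable_bound[OF int]) (use le in \<open>auto intro!: AE_I2 order_trans[OF le]\<close>)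
    qed (use int le in auto)
    then show ?thesis by (simp add: enn2real_etmn_L)
  qed
  have "etmn_L ?\<omega> \<le> etmn_L (isotropic (1 / 2) 0 :: 'n param)"
  proof (rule etmn_L_mono)
    fix w :: "real ^ 'n" assume "w \<in> nonneg_orthant"
    then have "0 \<le> ?\<sigma> w" by (simp add: nonneg_orthant_def sum_nonneg)
    moreover have "0 \<le> \<epsilon> * (norm w)\<^sup>2" using \<epsilon> by simp
    ultimately show "etmn_exponent ?\<omega> w \<le> etmn_exponent (isotropic (1 / 2) 0) w"
      unfolding etmn_exponent_isotropic by linarith
  qed
  then have fin\<epsilon>: "etmn_L ?\<omega> < \<infinity>" using fin by (rule le_less_trans)
  have le1: "etmn_L (isotropic 1 1 :: 'n param) \<le> etmn_L ?\<omega>"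
    using \<epsilon> by (intro etmn_L_mono) (simp add: etmn_exponent_isotropic mult_left_le_one_le)
  have den: "0 < enn2real (etmn_L (isotropic 1 1 :: 'n param))"
    using etmn_L_pos[of "isotropic 1 1 :: 'n param"] le1 fin\<epsilon>
    by (auto simp: enn2real_positive_iff)
  have "\<bar>deriv (\<lambda>h. etmn_K (?\<omega> + h *\<^sub>R \<eta>)) 0\<bar>
      \<le> 16 * N * enn2real (etmn_L (isotropic (1 / 2) 0 :: 'n param))
        / enn2real (etmn_L (isotropic 1 1 :: 'n param))"
    unfolding deriv abs_divide
  proof (intro frac_le num den)
    show "enn2real (etmn_L (isotropic 1 1 :: 'n param)) \<le> \<bar>enn2real (etmn_L ?\<omega>)\<bar>"
      using enn2real_mono[OF le1] fin\<epsilon> by simp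
  qed (use N in auto)
  then show ?thesis by (simp add: gradient_bound_def N_def algebra_simps)
qed

text \<open>The entries of both gradients are directional derivatives, up to the factors \<open>1/2\<close> and \<open>1\<close> of
  the symmetric convention.\<close>

lemma grad_norm_etmn_K_bounded:
  obtains B where "\<And>\<epsilon>. 0 < \<epsilon> \<Longrightarrow> \<epsilon> \<le> 1 \<Longrightarrow> grad_norm etmn_K (isotropic 1 \<epsilon> :: 'n::finite param) \<le> B"
proof
  let ?C = "gradient_bound TYPE('n)"
  fix \<epsilon> :: real
  assume \<epsilon>: "0 < \<epsilon>" "\<epsilon> \<le> 1"
  let ?\<omega> = "isotropic 1 \<epsilon> :: 'n param"
  have "\<bar>grad_theta etmn_K ?\<omega> $ i\<bar> \<le> ?C" for i
    using abs_deriv_etmn_K_le[OF \<epsilon>, of "(axis i 1, 0)"]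
    by (simp add: grad_theta_def isotropic_def)
  then have 1: "norm (grad_theta etmn_K ?\<omega>) \<le> (\<Sum>i\<in>(UNIV::'n set). ?C)"
    by (intro order_trans[OF norm_le_l1_cart] sum_mono)
  have "\<bar>grad_Theta etmn_K ?\<omega> $ i $ j\<bar> \<le> ?C * norm (sym_unit i j)" for i j
  proof -
    let ?d = "deriv (\<lambda>h. etmn_K (?\<omega> + h *\<^sub>R (0, sym_unit i j))) 0"
    have "grad_Theta etmn_K ?\<omega> $ i $ j = 1 / 2 * (1 + (if i = j then 1 else 0)) * ?d"
      by (simp add: grad_Theta_def isotropic_def)
    also have "\<bar>\<dots>\<bar> \<le> 1 * \<bar>?d\<bar>"
      unfolding abs_mult by (intro mult_right_mono) auto
    also have "1 * \<bar>?d\<bar> \<le> ?C * norm (sym_unit i j)"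
      using abs_deriv_etmn_K_le[OF \<epsilon>, of "(0, sym_unit i j)"] by simp
    finally show ?thesis .
  qed
  then have "norm (grad_Theta etmn_K ?\<omega> $ i) \<le> (\<Sum>j\<in>UNIV. ?C * norm (sym_unit i j))" for i
    by (intro order_trans[OF norm_le_l1_cart] sum_mono)
  then have "(\<Sum>i\<in>UNIV. norm (grad_Theta etmn_K ?\<omega> $ i))
      \<le> (\<Sum>i\<in>(UNIV::'n set). \<Sum>j\<in>UNIV. ?C * norm (sym_unit i j))"
    by (rule sum_mono)
  moreover have "norm (grad_Theta etmn_K ?\<omega>) \<le> (\<Sum>i\<in>UNIV. norm (grad_Theta etmn_K ?\<omega> $ i))"
    unfolding norm_vec_def[of "grad_Theta etmn_K ?\<omega>"] by (rule L2_set_le_sum) simp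
  ultimately have 2: "norm (grad_Theta etmn_K ?\<omega>)
      \<le> (\<Sum>i\<in>(UNIV::'n set). \<Sum>j\<in>UNIV. ?C * norm (sym_unit i j))"
    by linarith
  show "grad_norm etmn_K ?\<omega> \<le> (\<Sum>i\<in>(UNIV::'n set). ?C)
      + (\<Sum>i\<in>(UNIV::'n set). \<Sum>j\<in>UNIV. ?C * norm (sym_unit i j))"
    unfolding grad_norm_def
    by (rule order_trans[OF sqrt_sum_squares_le_sum]) (use 1 2 in auto)
qed

section \<open>Failure of steepness\<close>

theorem theorem3p1:
  shows "\<not> steep (etmn_family :: 'n::finite exp_family)"
proof
  let ?X = "\<lambda>n. isotropic 1 (inverse (real (Suc n))) :: 'n param"
  let ?I = "param_top interior_of (etmn_D :: 'n param set)"
  assume "steep (etmn_family :: 'n exp_family)"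
  then have "steep_at (etmn_family :: 'n exp_family) (isotropic 1 0)"
    using isotropic_in_frontier[of 1, where 'n = 'n] by (simp add: steep_def etmn_family_def)
  then have lim: "filterlim (grad_norm etmn_K) at_top (at (isotropic 1 0 :: 'n param) within ?I)"
    by (simp add: steep_at_def etmn_family_def)
  \<comment> \<open>the punctured limit in the definition of steepness excludes the boundary point itself\<close>
  have "?X n \<noteq> isotropic 1 0" for n
  proof
    assume "?X n = isotropic 1 0"
    then have "(inverse (real (Suc n)) *\<^sub>R mat 1 :: real ^ 'n ^ 'n) = 0"
      by (simp add: isotropic_def)
    then have "(inverse (real (Suc n)) *\<^sub>R mat 1 :: real ^ 'n ^ 'n) $ undefined $ undefined = 0"
      by (simp only: zero_index)
    then show False by (simp add: mat_def)
  qed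
  then have "filterlim ?X (at (isotropic 1 0) within ?I) sequentially"
    using isotropic_tendsto[OF LIMSEQ_inverse_real_of_nat, of 1, where 'n = 'n] isotropic_in_interior[where 'n = 'n]
    by (simp add: filterlim_at)
  from filterlim_compose[OF lim this]
  have top: "filterlim (\<lambda>n. grad_norm etmn_K (?X n)) at_top sequentially" .
  obtain B where B: "\<And>\<epsilon>. 0 < \<epsilon> \<Longrightarrow> \<epsilon> \<le> 1 \<Longrightarrow> grad_norm etmn_K (isotropic 1 \<epsilon> :: 'n param) \<le> B"
    by (rule grad_norm_etmn_K_bounded) blast
  have "eventually (\<lambda>n. B < grad_norm etmn_K (?X n)) sequentially"
    using top by (simp add: filterlim_at_top_dense)
  then obtain n where "B < grad_norm etmn_K (?X n)"
    by (auto simp: eventually_sequentially)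
  moreover have "grad_norm etmn_K (?X n) \<le> B"
    by (rule B) (simp_all add: field_simps)
  ultimately show False by simp
qed

end
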